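(* Let $U\ge 0$ and suppose the back-order system $\mathcal{B}$ and the lost sales system $\mathcal{L}$ both operate under a PIL policy with level $U$, starting from the same initial state $\mathbf{x}_0=\mathbf{x}$. Then for any initial state $\mathbf{x}$ such that the projected inventory level $U$ can be attained (i.e. $\mathbb{E}[J_{\tau-1}\mid\mathbf{x}_0=\mathbf{x}]\le U$), and for any $t\ge\tau$, $$p\,\mathbb{E}[L_t]+h\,\mathbb{E}[J_t]=\mathbb{E}[c_t]\le\mathbb{E}[c^{\mathcal{B}}_t]=p\,\mathbb{E}[B_t]+h\,\mathbb{E}[J^{\mathcal{B}}_t].$$
   Context: Lost sales system $\mathcal{L}$. Periods are $t\in\mathbb{N}_0=\{0,1,2,\dots\}$; $\tau\in\mathbb{N}_0$ is the lead time, $h>0$ the holding cost and $p>0$ the lost sales penalty cost. Demands $D_0,D_1,\dots$ are i.i.d. nonnegative random variables with $\mu=\mathbb{E}[D_t]<\infty$. $q_t\ge 0$ is the order arriving at the start of period $t$; the order $q_{t+\tau}$ is placed in period $t$, before $D_t$ is observed. $I_t$ is the inventory at the start of period $t$ after receiving $q_t$. With $(x)^+=\max(0,x)$, the dynamics are $L_t=(D_t-I_t)^+$ (lost sales), $J_t=(I_t-D_t)^+$ (end-of-period inventory), $I_t=J_{t-1}+q_t$. The state in period $t$ is $\mathbf{x}_t=(I_t,q_{t+1},\dots,q_{t+\tau-1})\in\mathbb{R}_+^\tau$ (for $\tau=0$ it is the inventory $J_{t-1}$ before ordering); the initial state $\mathbf{x}_0$ is deterministic. The PIL policy with level $U$ orders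 $q_{t+\tau}=(U-\mathbb{E}[J_{t+\tau-1}\mid\mathbf{x}_t])^+$. The cost in period $t$ is $c_t=hJ_t+pL_t$. Back-order system $\mathcal{B}$: defined on the same probability space with the same demands, the same initial inventory level and initial pipeline of orders, the same $\tau$ and $h$, and back-order cost $p$ per item per period. Dynamics $I^{\mathcal{B}}_t=I^{\mathcal{B}}_{t-1}-D_{t-1}+q^{\mathcal{B}}_t$, $J^{\mathcal{B}}_t=(I^{\mathcal{B}}_t-D_t)^+$, $B_t=(D_t-I^{\mathcal{B}}_t)^+$, cost $c^{\mathcal{B}}_t=hJ^{\mathcal{B}}_t+pB_t$. The PIL policy with level $U$ in $\mathcal{B}$ places the order $q^{\mathcal{B}}_{t+\tau}$ in period $t$ so that the expected inventory level $I^{\mathcal{B}}_{t+\tau}$, given the state in period $t$, equals $U$; equivalently it is the base-stock policy with level $S=U+\tau\mu$, $q^{\mathcal{B}}_{t+\tau}=S-I^{\mathcal{B}}_t-\sum_{i=t+1}^{t+\tau-1}q^{\mathcal{B}}_i$ (for $\tau=0$, the order raises the net inventory level to $U$). *)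

theory Defs
  imports "HOL-Probability.Probability"
begin

text \<open>
  Common arguments: \<open>\<tau>\<close> is the lead time, \<open>D\<close> the demand process and \<open>q\<close> the order process, where
  \<open>q t\<close> is the order that arrives at the start of period \<open>t\<close>. The initial state is a vector \<open>x\<close> of
  \<open>max 1 \<tau>\<close> numbers: for \<open>\<tau> \<ge> 1\<close>, \<open>x 0\<close> is the inventory \<open>I\<^sub>0\<close> after receiving the order of
  period 0, and \<open>x i\<close> is the pipeline order \<open>q i\<close> for \<open>1 \<le> i < \<tau>\<close>; for \<open>\<tau> = 0\<close>, \<open>x 0\<close> is the
  inventory \<open>J\<^sub>-\<^sub>1\<close> before the order of period 0. Hence \<open>q 0\<close> is not used when \<open>\<tau> \<ge> 1\<close>.
\<close>

type_synonym 'a proc = "nat \<Rightarrow> 'a \<Rightarrow> real"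


subsection \<open>Lost sales system\<close>

fun ls_I :: "nat \<Rightarrow> (nat \<Rightarrow> real) \<Rightarrow> 'a proc \<Rightarrow> 'a proc \<Rightarrow> 'a proc" where
  "ls_I \<tau> x D q 0 \<omega> = (if \<tau> = 0 then x 0 + q 0 \<omega> else x 0)"
| "ls_I \<tau> x D q (Suc t) \<omega> = max 0 (ls_I \<tau> x D q t \<omega> - D t \<omega>) + q (Suc t) \<omega>"

definition ls_J :: "nat \<Rightarrow> (nat \<Rightarrow> real) \<Rightarrow> 'a proc \<Rightarrow> 'a proc \<Rightarrow> 'a proc" where
  "ls_J \<tau> x D q t \<omega> = max 0 (ls_I \<tau> x D q t \<omega> - D t \<omega>)"

definition ls_L :: "nat \<Rightarrow> (nat \<Rightarrow> real) \<Rightarrow> 'a proc \<Rightarrow> 'a proc \<Rightarrow> 'a proc" where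
  "ls_L \<tau> x D q t \<omega> = max 0 (D t \<omega> - ls_I \<tau> x D q t \<omega>)"

definition ls_cost :: "real \<Rightarrow> real \<Rightarrow> nat \<Rightarrow> (nat \<Rightarrow> real) \<Rightarrow> 'a proc \<Rightarrow> 'a proc \<Rightarrow> 'a proc" where
  "ls_cost h p \<tau> x D q t \<omega> = h * ls_J \<tau> x D q t \<omega> + p * ls_L \<tau> x D q t \<omega>"

text \<open>
  \<open>ls_prev \<tau> x D q t\<close> is \<open>J\<^sub>t\<^sub>-\<^sub>1\<close>. Its value at \<open>t = 0\<close> is meaningful, and used below, only for
  \<open>\<tau> = 0\<close>.
\<close>

definition ls_prev :: "nat \<Rightarrow> (nat \<Rightarrow> real) \<Rightarrow> 'a proc \<Rightarrow> 'a proc \<Rightarrow> 'a proc" where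
  "ls_prev \<tau> x D q t = (case t of 0 \<Rightarrow> (\<lambda>_. x 0) | Suc s \<Rightarrow> ls_J \<tau> x D q s)"


subsection \<open>Back-order system\<close>

fun bo_I :: "nat \<Rightarrow> (nat \<Rightarrow> real) \<Rightarrow> 'a proc \<Rightarrow> 'a proc \<Rightarrow> 'a proc" where
  "bo_I \<tau> x D q 0 \<omega> = (if \<tau> = 0 then x 0 + q 0 \<omega> else x 0)"
| "bo_I \<tau> x D q (Suc t) \<omega> = bo_I \<tau> x D q t \<omega> - D t \<omega> + q (Suc t) \<omega>"

definition bo_J :: "nat \<Rightarrow> (nat \<Rightarrow> real) \<Rightarrow> 'a proc \<Rightarrow> 'a proc \<Rightarrow> 'a proc" where
  "bo_J \<tau> x D q t \<omega> = max 0 (bo_I \<tau> x D q t \<omega> - D t \<omega>)"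

definition bo_B :: "nat \<Rightarrow> (nat \<Rightarrow> real) \<Rightarrow> 'a proc \<Rightarrow> 'a proc \<Rightarrow> 'a proc" where
  "bo_B \<tau> x D q t \<omega> = max 0 (D t \<omega> - bo_I \<tau> x D q t \<omega>)"

definition bo_cost :: "real \<Rightarrow> real \<Rightarrow> nat \<Rightarrow> (nat \<Rightarrow> real) \<Rightarrow> 'a proc \<Rightarrow> 'a proc \<Rightarrow> 'a proc" where
  "bo_cost h p \<tau> x D q t \<omega> = h * bo_J \<tau> x D q t \<omega> + p * bo_B \<tau> x D q t \<omega>"

text \<open>The net inventory level at the end of period \<open>t - 1\<close>; as for \<open>ls_prev\<close>, its value at
  \<open>t = 0\<close> is meaningful, and used below, only for \<open>\<tau> = 0\<close>.\<close>

definition bo_prev :: "nat \<Rightarrow> (nat \<Rightarrow> real) \<Rightarrow> 'a proc \<Rightarrow> 'a proc \<Rightarrow> 'a proc" where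
  "bo_prev \<tau> x D q t = (case t of 0 \<Rightarrow> (\<lambda>_. x 0) | Suc s \<Rightarrow> (\<lambda>\<omega>. bo_I \<tau> x D q s \<omega> - D s \<omega>))"


subsection \<open>State information\<close>

text \<open>
  The state in period \<open>t\<close> is \<open>(I t, q (t+1), \<dots>, q (t+\<tau>-1))\<close> for \<open>\<tau> \<ge> 1\<close>, and \<open>Y t\<close>, the (net)
  inventory before ordering, for \<open>\<tau> = 0\<close>.
\<close>

definition sys_state :: "nat \<Rightarrow> 'a proc \<Rightarrow> 'a proc \<Rightarrow> 'a proc \<Rightarrow> nat \<Rightarrow> 'a \<Rightarrow> nat \<Rightarrow> real" where
  "sys_state \<tau> Y I q t \<omega> =
     (\<lambda>i\<in>{..<max 1 \<tau>}. if i = 0 then (if \<tau> = 0 then Y t \<omega> else I t \<omega>) else q (t + i) \<omega>)"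

text \<open>The sigma-algebra generated by a random state vector.\<close>

definition state_algebra :: "'a measure \<Rightarrow> nat \<Rightarrow> ('a \<Rightarrow> nat \<Rightarrow> real) \<Rightarrow> 'a measure" where
  "state_algebra M \<tau> X = vimage_algebra (space M) X (Pi\<^sub>M {..<max 1 \<tau>} (\<lambda>_. borel))"

definition ls_algebra ::
  "'a measure \<Rightarrow> nat \<Rightarrow> (nat \<Rightarrow> real) \<Rightarrow> 'a proc \<Rightarrow> 'a proc \<Rightarrow> nat \<Rightarrow> 'a measure" where
  "ls_algebra M \<tau> x D q t =
     state_algebra M \<tau> (sys_state \<tau> (ls_prev \<tau> x D q) (ls_I \<tau> x D q) q t)"

definition bo_algebra ::
  "'a measure \<Rightarrow> nat \<Rightarrow> (nat \<Rightarrow> real) \<Rightarrow> 'a proc \<Rightarrow> 'a proc \<Rightarrow> nat \<Rightarrow> 'a measure" where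
  "bo_algebra M \<tau> x D q t =
     state_algebra M \<tau> (sys_state \<tau> (bo_prev \<tau> x D q) (bo_I \<tau> x D q) q t)"


subsection \<open>Projected inventory level policies\<close>

definition initial_pipeline :: "'a measure \<Rightarrow> nat \<Rightarrow> (nat \<Rightarrow> real) \<Rightarrow> 'a proc \<Rightarrow> bool" where
  "initial_pipeline M \<tau> x q \<longleftrightarrow> (\<forall>i. 1 \<le> i \<and> i < \<tau> \<longrightarrow> (\<forall>\<omega>\<in>space M. q i \<omega> = x i))"

text \<open>
  The order placed in period \<open>t\<close> arrives in period \<open>t + \<tau>\<close> and is some version of
  \<open>(U - E[J\<^sub>t\<^sub>+\<^sub>\<tau>\<^sub>-\<^sub>1 | x\<^sub>t])\<^sup>+\<close>: it is a function of the state, almost surely equal to this expression.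
\<close>

definition ls_PIL ::
  "'a measure \<Rightarrow> nat \<Rightarrow> (nat \<Rightarrow> real) \<Rightarrow> 'a proc \<Rightarrow> real \<Rightarrow> 'a proc \<Rightarrow> bool" where
  "ls_PIL M \<tau> x D U q \<longleftrightarrow>
     (\<forall>t. q (t + \<tau>) \<in> borel_measurable (ls_algebra M \<tau> x D q t) \<and>
          (AE \<omega> in M. q (t + \<tau>) \<omega> =
             max 0 (U - real_cond_exp M (ls_algebra M \<tau> x D q t) (ls_prev \<tau> x D q (t + \<tau>)) \<omega>)))"

text \<open>
  In the back-order system the order placed in period \<open>t\<close> is a function of the state such that the
  conditional expectation of \<open>I\<^sub>t\<^sub>+\<^sub>\<tau>\<close> given the state is \<open>U\<close>. Integrability is listed because
  \<^const>\<open>real_cond_exp\<close> is a total function.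
\<close>

definition bo_PIL ::
  "'a measure \<Rightarrow> nat \<Rightarrow> (nat \<Rightarrow> real) \<Rightarrow> 'a proc \<Rightarrow> real \<Rightarrow> 'a proc \<Rightarrow> bool" where
  "bo_PIL M \<tau> x D U q \<longleftrightarrow>
     (\<forall>t. q (t + \<tau>) \<in> borel_measurable (bo_algebra M \<tau> x D q t) \<and>
          integrable M (bo_I \<tau> x D q (t + \<tau>)) \<and>
          (AE \<omega> in M. real_cond_exp M (bo_algebra M \<tau> x D q t) (bo_I \<tau> x D q (t + \<tau>)) \<omega> = U))"

end

theory Submission
  imports Defs
begin

text \<open>
  Fix a period \<open>s\<close> and put \<open>t = s + \<tau>\<close>. In the back-order system the inventory position in period
  \<open>s\<close> is almost surely \<open>U + \<tau> \<mu>\<close>, so \<open>I\<^sub>t\<close> is \<open>U + \<tau> \<mu>\<close> minus the lead time demand. In the lost sales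
  system the conditional mean of \<open>I\<^sub>t\<close> given the state in period \<open>s\<close> is \<open>U\<close>: a projected inventory
  level that does not exceed \<open>U\<close> before ordering keeps this property, because receiving every order one
  period earlier only increases the lost sales. The costs are then compared one period of the lead
  time at a time. As functions of the demand \<open>d\<close> of one period, the projected level \<open>a d\<close> of the lost
  sales system is nonincreasing with slope at least \<open>-1\<close>, while that of the back-order system is
  \<open>c - d\<close>. Both have the same mean, so they cross once and \<open>a d\<close> is below \<open>c - d\<close> in the convex
  order.
\<close>

subsection \<open>Projected inventory and convex comparison\<close>

text \<open>The mean of \<open>I (t + n)\<close> in the lost sales system, given \<open>I t = i\<close> and the pipeline
  \<open>q (t + 1 + r) = q r\<close> for \<open>r < n\<close>.\<close>

primrec proj_inv :: "real measure \<Rightarrow> nat \<Rightarrow> real \<Rightarrow> (nat \<Rightarrow> real) \<Rightarrow> real" where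
  "proj_inv \<nu> 0 i q = i"
| "proj_inv \<nu> (Suc n) i q = (\<integral>d. proj_inv \<nu> n (max 0 (i - d) + q 0) (\<lambda>r. q (Suc r)) \<partial>\<nu>)"

text \<open>The mean of \<open>\<phi>\<close> at the back-order inventory level \<open>n\<close> periods later, where \<open>y\<close> already includes
  the orders that arrive until then.\<close>

primrec bo_value :: "real measure \<Rightarrow> (real \<Rightarrow> real) \<Rightarrow> nat \<Rightarrow> real \<Rightarrow> real" where
  "bo_value \<nu> \<phi> 0 y = \<phi> y"
| "bo_value \<nu> \<phi> (Suc n) y = (\<integral>d. bo_value \<nu> \<phi> n (y - d) \<partial>\<nu>)"

text \<open>The slopes \<open>s x\<close> are right derivatives, and each gives a supporting line.
  Adding the supporting inequalities at \<open>x\<close> and at \<open>z\<close> orders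
  \<open>s x\<close> and \<open>s z\<close> like \<open>x\<close> and \<open>z\<close>. Hence the
  single slope \<open>k = s z\<close> bounds the increment of \<open>W\<close> from below on every
  step that leads away from \<open>z\<close>, even if the step starts at \<open>x\<close> instead of
  \<open>z\<close>.\<close>

lemma convex_on_secant_mono:
  fixes W :: "real \<Rightarrow> real"
  assumes "convex_on UNIV W"
  obtains k where
    "\<And>x y. z \<le> x \<Longrightarrow> x \<le> y \<Longrightarrow> W x + k * (y - x) \<le> W y"
    "\<And>x y. y \<le> x \<Longrightarrow> x \<le> z \<Longrightarrow> W x + k * (y - x) \<le> W y"
proof -
  define s where "s x = Inf ((\<lambda>t. (W x - W t) / (x - t)) ` ({x<..} \<inter> UNIV))" for x
  have tangent: "W x + s x * (y - x) \<le> W y" for x y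
    unfolding s_def by (rule convex_le_Inf_differential[OF assms]) auto
  have "0 \<le> (s x - s z) * (x - z)" for x
    using tangent[of x z] tangent[of z x] by (simp add: algebra_simps)
  then have *: "z < x \<Longrightarrow> s z \<le> s x" "x < z \<Longrightarrow> s x \<le> s z" for x
    by (smt (verit) zero_le_mult_iff)+
  show ?thesis
  proof (rule that[of "s z"])
    fix x y :: real
    show "W x + s z * (y - x) \<le> W y" if "z \<le> x" "x \<le> y"
      using tangent[of x y] mult_right_mono[of "s z" "s x" "y - x"] *(1)[of x] that
      by (cases "x = z") auto
    show "W x + s z * (y - x) \<le> W y" if "y \<le> x" "x \<le> z"
      using tangent[of x y] mult_right_mono_neg[of "s x" "s z" "y - x"] *(2)[of x] that
      by (cases "x = z") auto
  qed
qed

lemma (in prob_space) integrable_compose_lipschitz: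
  fixes f :: "real \<Rightarrow> real"
  assumes f: "C-lipschitz_on UNIV f" and X: "integrable M X"
  shows "integrable M (\<lambda>\<omega>. f (X \<omega>))"
proof (rule Bochner_Integration.integrable_bound)
  show "integrable M (\<lambda>\<omega>. \<bar>f 0\<bar> + C * \<bar>X \<omega>\<bar>)"
    using X by auto
  show "(\<lambda>\<omega>. f (X \<omega>)) \<in> borel_measurable M"
    using X borel_measurable_continuous_onI[OF lipschitz_on_continuous_on[OF f]] by measurable
  have "\<bar>f y\<bar> \<le> \<bar>f 0\<bar> + C * \<bar>y\<bar>" for y
    using lipschitz_onD[OF f, of y 0] by (auto simp: dist_real_def)
  then show "AE \<omega> in M. norm (f (X \<omega>)) \<le> norm (\<bar>f 0\<bar> + C * \<bar>X \<omega>\<bar>)"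
    by (auto intro!: AE_I2 intro: order_trans[OF _ abs_ge_self])
qed

locale demand_law = real_distribution \<nu> for \<nu> +
  assumes integrable_ident: "integrable \<nu> (\<lambda>d. d)"
begin

abbreviation mean :: real where
  "mean \<equiv> \<integral>d. d \<partial>\<nu>"

lemma integrable_lipschitz:
  fixes f :: "real \<Rightarrow> real"
  assumes "C-lipschitz_on UNIV f"
  shows "integrable \<nu> f"
  by (rule integrable_compose_lipschitz[OF assms integrable_ident])

lemma integrable_lipschitz_nonexpansive:
  fixes f :: "real \<Rightarrow> real"
  assumes "C-lipschitz_on UNIV f" and "1-lipschitz_on UNIV g"
  shows "integrable \<nu> (\<lambda>d. f (g d))"
  by (rule integrable_compose_lipschitz[OF assms(1) integrable_lipschitz[OF assms(2)]])

lemma lipschitz_integral: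
  fixes f :: "real \<Rightarrow> real \<Rightarrow> real"
  assumes "\<And>d. C-lipschitz_on UNIV (\<lambda>y. f y d)" and int: "\<And>y. integrable \<nu> (f y)"
  shows "C-lipschitz_on UNIV (\<lambda>y. \<integral>d. f y d \<partial>\<nu>)"
proof (rule lipschitz_onI)
  fix y z :: real
  have "\<bar>(\<integral>d. f y d \<partial>\<nu>) - (\<integral>d. f z d \<partial>\<nu>)\<bar> = \<bar>\<integral>d. f y d - f z d \<partial>\<nu>\<bar>"
    by (simp add: int)
  also have "\<dots> \<le> (\<integral>d. \<bar>f y d - f z d\<bar> \<partial>\<nu>)"
    by (rule integral_abs_bound)
  also have "\<dots> \<le> (\<integral>d. C * dist y z \<partial>\<nu>)"
    using lipschitz_onD[OF assms(1)] by (intro integral_mono) (auto simp: int dist_real_def)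
  finally show "dist (\<integral>d. f y d \<partial>\<nu>) (\<integral>d. f z d \<partial>\<nu>) \<le> C * dist y z"
    by (simp add: dist_real_def prob_space[simplified])
qed (use assms lipschitz_on_nonneg in blast)

text \<open>At the crossing point \<open>z\<close>, a supporting line of \<open>W\<close> at \<open>a z\<close> with slope \<open>k\<close> gives
  \<open>W (c - d) - W (a d) \<ge> k (c - d - a d)\<close> on both sides of \<open>z\<close>.\<close>

lemma convex_integral_le_of_single_crossing:
  fixes a W :: "real \<Rightarrow> real"
  assumes conv: "convex_on UNIV W" and W: "C-lipschitz_on UNIV W"
    and anti: "antimono a" and a: "1-lipschitz_on UNIV a"
    and c: "(\<integral>d. a d \<partial>\<nu>) = c - (\<integral>d. d \<partial>\<nu>)"
  shows "(\<integral>d. W (a d) \<partial>\<nu>) \<le> (\<integral>d. W (c - d) \<partial>\<nu>)"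
proof -
  \<comment> \<open>\<open>g\<close> is the gap between the back-order level and the lost sales
    level. It is nonincreasing because \<open>a\<close>, being 1-Lipschitz, never falls faster than
    \<open>c - d\<close>.\<close>
  define g where "g d = c - d - a d" for d
  have int_a: "integrable \<nu> a" by (rule integrable_lipschitz[OF a])
  have int_g: "integrable \<nu> g" unfolding g_def using int_a integrable_ident by auto
  have g0: "(\<integral>d. g d \<partial>\<nu>) = 0"
    unfolding g_def using int_a integrable_ident c prob_space by simp
  have g_anti: "g y \<le> g x" if "x \<le> y" for x y
    using lipschitz_onD[OF a, of x y] that unfolding g_def dist_real_def by auto
  \<comment> \<open>Under a probability measure a function with mean 0 is neither positive
    everywhere nor negative everywhere. The two points feed the intermediate value theorem.\<close>
  obtain d1 where d1: "g d1 \<le> 0"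
    using expectation_greater[OF int_g, of 0] g0 by (metis AE_I2 less_irrefl not_le)
  obtain d2 where d2: "0 \<le> g d2"
    using expectation_less[OF int_g, of 0] g0 by (metis AE_I2 less_irrefl not_le)
  have cont: "isCont g d" for d
    unfolding g_def using lipschitz_on_continuous_on[OF a]
    by (auto intro!: continuous_intros simp: continuous_on_eq_continuous_at)
  obtain z where "g z = 0"
  proof (cases "d2 \<le> d1")
    case True
    then show ?thesis using IVT2[of g d1 0 d2] d1 d2 cont that by blast
  next
    case False
    then have "g d2 = 0" using g_anti[of d1 d2] d1 d2 by linarith
    then show ?thesis by (rule that)
  qed
  obtain k where k:
    "\<And>x y. a z \<le> x \<Longrightarrow> x \<le> y \<Longrightarrow> W x + k * (y - x) \<le> W y"
    "\<And>x y. y \<le> x \<Longrightarrow> x \<le> a z \<Longrightarrow> W x + k * (y - x) \<le> W y"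
    using convex_on_secant_mono[OF conv, of "a z"] by metis
  \<comment> \<open>Left of \<open>z\<close> the gap is nonnegative and
    \<open>a z <= a d <= c - d\<close>; right of \<open>z\<close> all these inequalities are
    reversed. In both cases the step from \<open>a d\<close> to \<open>c - d\<close> leads away from
    \<open>a z\<close>, which is where the slope \<open>k\<close> is valid.\<close>
  have "W (a d) + k * g d \<le> W (c - d)" for d
  proof (cases "d \<le> z")
    case True
    then show ?thesis
      using k(1)[of "a d" "c - d"] antimonoD[OF anti, of d z] g_anti[of d z] \<open>g z = 0\<close>
      by (simp add: g_def algebra_simps)
  next
    case False
    then show ?thesis
      using k(2)[of "c - d" "a d"] antimonoD[OF anti, of z d] g_anti[of z d] \<open>g z = 0\<close>
      by (simp add: g_def algebra_simps)
  qed
  moreover have int_W: "integrable \<nu> (\<lambda>d. W (a d))"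
    by (rule integrable_lipschitz_nonexpansive[OF W a])
  moreover have "integrable \<nu> (\<lambda>d. W (c - d))"
    by (intro integrable_lipschitz_nonexpansive[OF W]) (auto intro!: lipschitz_onI simp: dist_real_def)
  ultimately have "(\<integral>d. W (a d) + k * g d \<partial>\<nu>) \<le> (\<integral>d. W (c - d) \<partial>\<nu>)"
    using int_g by (intro integral_mono) auto
  then show ?thesis
    using int_W int_g g0 by simp
qed

section \<open>Monotonicity, Lipschitz bounds and measurability of the projected inventory
  level\<close>

lemma lipschitz_max_diff:
  "1-lipschitz_on UNIV (\<lambda>d. max 0 (i - d) + r)" "1-lipschitz_on UNIV (\<lambda>i. max 0 (i - d) + r)"
  for i d r :: real
  by (auto intro!: lipschitz_onI simp: dist_real_def)

text \<open>The positive part and shifts are nonexpansive, and averaging over the demand preserves a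
  Lipschitz constant, so the constant 1 survives any number of periods. This is the source of the
  slope bound behind the single crossing.\<close>

lemma proj_inv_lipschitz: "1-lipschitz_on UNIV (\<lambda>i. proj_inv \<nu> n i q)"
proof (induction n arbitrary: q)
  case 0
  show ?case by (auto intro: lipschitz_onI)
next
  case (Suc n)
  have "1-lipschitz_on UNIV (\<lambda>y. proj_inv \<nu> n (f y) (\<lambda>r. q (Suc r)))"
    if "1-lipschitz_on UNIV f" for f
    using lipschitz_on_compose2[OF that lipschitz_on_subset[OF Suc subset_UNIV]] by simp
  then show ?case
    by (auto intro!: lipschitz_integral integrable_lipschitz lipschitz_max_diff)
qed

lemma proj_inv_step_lipschitz:
  "1-lipschitz_on UNIV (\<lambda>d. proj_inv \<nu> n (max 0 (i - d) + r) q)"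
  using lipschitz_on_compose2[OF lipschitz_max_diff(1)
    lipschitz_on_subset[OF proj_inv_lipschitz subset_UNIV]] by simp

lemma proj_inv_step_integrable:
  "integrable \<nu> (\<lambda>d. proj_inv \<nu> n (max 0 (i - d) + r) q)"
  by (rule integrable_lipschitz[OF proj_inv_step_lipschitz])

lemma proj_inv_mono: "i \<le> i' \<Longrightarrow> proj_inv \<nu> n i q \<le> proj_inv \<nu> n i' q"
  by (induction n arbitrary: i i' q) (auto intro!: integral_mono proj_inv_step_integrable)

text \<open>On the left every order arrives one period earlier than on the right, with no more total
  supply. Stock available earlier serves at least as much demand, so no more of it remains at the
  end. The first hypothesis is the invariant of the induction: under the same demand
  \<open>d\<close> it passes to the next period because
  \<open>max 0 (i' + q 0 - d) <= max 0 (i' - d) + q 0\<close>.\<close>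

lemma proj_inv_early_le:
  assumes "i \<le> i' + q 0" and "\<And>r. r \<le> n \<Longrightarrow> 0 \<le> q r"
  shows "proj_inv \<nu> n i (\<lambda>r. q (Suc r)) \<le> proj_inv \<nu> n i' q + q n"
  using assms
proof (induction n arbitrary: i i' q)
  case (Suc n)
  have "proj_inv \<nu> n (max 0 (i - d) + q (Suc 0)) (\<lambda>r. q (Suc (Suc r)))
      \<le> proj_inv \<nu> n (max 0 (i' - d) + q 0) (\<lambda>r. q (Suc r)) + q (Suc n)" for d
    using Suc.prems Suc.prems(2)[of 0] by (intro Suc.IH) auto
  then have "(\<integral>d. proj_inv \<nu> n (max 0 (i - d) + q (Suc 0)) (\<lambda>r. q (Suc (Suc r))) \<partial>\<nu>)
      \<le> (\<integral>d. proj_inv \<nu> n (max 0 (i' - d) + q 0) (\<lambda>r. q (Suc r)) + q (Suc n) \<partial>\<nu>)"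
    by (intro integral_mono Bochner_Integration.integrable_add proj_inv_step_integrable) auto
  then show ?case
    using prob_space by (simp add: proj_inv_step_integrable)
qed auto

lemma proj_inv_cong: "(\<And>r. r < n \<Longrightarrow> q r = q' r) \<Longrightarrow> proj_inv \<nu> n i q = proj_inv \<nu> n i q'"
proof (induction n arbitrary: i q q')
  case (Suc n)
  have "proj_inv \<nu> n j (\<lambda>r. q (Suc r)) = proj_inv \<nu> n j (\<lambda>r. q' (Suc r))" for j
    by (rule Suc.IH) (rule Suc.prems, simp)
  then show ?case
    using Suc.prems[of 0] by simp
qed simp

text \<open>The pipeline is an infinite sequence here, so that dropping its first order is a
  measurable map of one product space into itself and the induction on \<open>n\<close> closes under
  the integral.\<close>

lemma measurable_proj_inv_pair:
  "(\<lambda>(i, q). proj_inv \<nu> n i q) \<in> borel_measurable (borel \<Otimes>\<^sub>M Pi\<^sub>M UNIV (\<lambda>_. borel))"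
proof (induction n)
  case (Suc n)
  note [measurable] = Suc
  have [measurable]: "(\<lambda>p. \<lambda>r. snd (fst p) (Suc r)) \<in>
      measurable ((borel \<Otimes>\<^sub>M Pi\<^sub>M UNIV (\<lambda>_. borel)) \<Otimes>\<^sub>M \<nu>) (Pi\<^sub>M UNIV (\<lambda>_. borel :: real measure))"
    by (rule measurable_PiM_single') auto
  have "(\<lambda>p. (\<lambda>(i, q). proj_inv \<nu> n i q)
        (max 0 (fst (fst p) - snd p) + snd (fst p) 0, \<lambda>r. snd (fst p) (Suc r)))
      \<in> borel_measurable ((borel \<Otimes>\<^sub>M Pi\<^sub>M UNIV (\<lambda>_. borel)) \<Otimes>\<^sub>M \<nu>)"
    by measurable
  then have *: "case_prod (\<lambda>p d. proj_inv \<nu> n (max 0 (fst p - d) + snd p 0) (\<lambda>r. snd p (Suc r)))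
      \<in> borel_measurable ((borel \<Otimes>\<^sub>M Pi\<^sub>M UNIV (\<lambda>_. borel)) \<Otimes>\<^sub>M \<nu>)"
    by (simp add: case_prod_beta)
  show ?case
    using borel_measurable_lebesgue_integral[OF *] by (simp add: case_prod_beta)
qed simp

lemma measurable_proj_inv:
  assumes [measurable]: "i \<in> borel_measurable N" and q: "\<And>r. r < n \<Longrightarrow> q r \<in> borel_measurable N"
  shows "(\<lambda>\<omega>. proj_inv \<nu> n (i \<omega>) (\<lambda>r. q r \<omega>)) \<in> borel_measurable N"
proof -
  \<comment> \<open>Only the first \<open>n\<close> orders are assumed measurable. The sequence is
    continued by 0, which leaves the projection unchanged by \<open>proj_inv_cong\<close>.\<close>
  have [measurable]: "(\<lambda>\<omega> r. if r < n then q r \<omega> else 0) \<in> measurable N (Pi\<^sub>M UNIV (\<lambda>_. borel))"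
  proof (rule measurable_PiM_single')
    show "(\<lambda>\<omega>. if r < n then q r \<omega> else 0) \<in> borel_measurable N" for r
      using q by (cases "r < n") auto
  qed auto
  have "(\<lambda>\<omega>. (\<lambda>(i, q). proj_inv \<nu> n i q) (i \<omega>, \<lambda>r. if r < n then q r \<omega> else 0))
      \<in> borel_measurable N"
    using measurable_proj_inv_pair[of n] by measurable
  moreover have "proj_inv \<nu> n (i \<omega>) (\<lambda>r. if r < n then q r \<omega> else 0)
      = proj_inv \<nu> n (i \<omega>) (\<lambda>r. q r \<omega>)" for \<omega>
    by (rule proj_inv_cong) simp
  ultimately show ?thesis
    by simp
qed

section \<open>Regularity of the back-order value and the one-period comparison\<close>

lemma bo_value_lipschitz:
  assumes "C-lipschitz_on UNIV \<phi>"
  shows "C-lipschitz_on UNIV (bo_value \<nu> \<phi> n)"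
proof (induction n)
  case (Suc n)
  have *: "C-lipschitz_on UNIV (\<lambda>y. bo_value \<nu> \<phi> n (f y))"
    if "1-lipschitz_on UNIV f" for f :: "real \<Rightarrow> real"
    using lipschitz_on_compose2[OF that lipschitz_on_subset[OF Suc subset_UNIV]] by simp
  have "C-lipschitz_on UNIV (\<lambda>y. \<integral>d. bo_value \<nu> \<phi> n (y - d) \<partial>\<nu>)"
  proof (rule lipschitz_integral)
    show "C-lipschitz_on UNIV (\<lambda>y. bo_value \<nu> \<phi> n (y - d))" for d
      by (rule *) (auto intro!: lipschitz_onI simp: dist_real_def)
    show "integrable \<nu> (\<lambda>d. bo_value \<nu> \<phi> n (y - d))" for y
      by (rule integrable_lipschitz_nonexpansive[OF Suc]) (auto intro!: lipschitz_onI simp: dist_real_def)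
  qed
  then show ?case by simp
qed (simp add: assms)

lemma bo_value_step_integrable:
  assumes "C-lipschitz_on UNIV \<phi>"
  shows "integrable \<nu> (\<lambda>d. bo_value \<nu> \<phi> n (y - d))"
  by (rule integrable_lipschitz_nonexpansive[OF bo_value_lipschitz[OF assms]])
    (auto intro!: lipschitz_onI simp: dist_real_def)

lemma convex_on_integral:
  fixes f :: "real \<Rightarrow> real \<Rightarrow> real"
  assumes "\<And>d. convex_on UNIV (\<lambda>y. f y d)" and int: "\<And>y. integrable \<nu> (f y)"
  shows "convex_on UNIV (\<lambda>y. \<integral>d. f y d \<partial>\<nu>)"
proof (rule convex_onI)
  fix t x y :: real
  assume "0 < t" "t < 1"
  then have "f ((1 - t) *\<^sub>R x + t *\<^sub>R y) d \<le> (1 - t) * f x d + t * f y d" for d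
    using convex_onD[OF assms(1), of t x y d] by simp
  then have "(\<integral>d. f ((1 - t) *\<^sub>R x + t *\<^sub>R y) d \<partial>\<nu>) \<le> (\<integral>d. (1 - t) * f x d + t * f y d \<partial>\<nu>)"
    by (intro integral_mono) (simp_all add: int)
  then show "(\<integral>d. f ((1 - t) *\<^sub>R x + t *\<^sub>R y) d \<partial>\<nu>)
      \<le> (1 - t) * (\<integral>d. f x d \<partial>\<nu>) + t * (\<integral>d. f y d \<partial>\<nu>)"
    by (simp add: int)
qed auto

lemma bo_value_convex:
  assumes "C-lipschitz_on UNIV \<phi>" and "convex_on UNIV \<phi>"
  shows "convex_on UNIV (bo_value \<nu> \<phi> n)"
proof (induction n)
  case (Suc n)
  have "convex_on UNIV (\<lambda>y. bo_value \<nu> \<phi> n (y - d))" for d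
  proof (rule convex_onI)
    fix t x y :: real
    assume "0 < t" "t < 1"
    then show "bo_value \<nu> \<phi> n ((1 - t) *\<^sub>R x + t *\<^sub>R y - d)
        \<le> (1 - t) * bo_value \<nu> \<phi> n (x - d) + t * bo_value \<nu> \<phi> n (y - d)"
      using convex_onD[OF Suc, of t "x - d" "y - d"] by (simp add: algebra_simps)
  qed auto
  then have "convex_on UNIV (\<lambda>y. \<integral>d. bo_value \<nu> \<phi> n (y - d) \<partial>\<nu>)"
    by (intro convex_on_integral bo_value_step_integrable[OF assms(1)])
  then show ?case by simp
qed (simp add: assms)

text \<open>The shift by \<open>n * mean\<close> turns a projected level into the back-order
  inventory position that has the same projection. The map \<open>?a\<close> inherits monotonicity
  and slope from \<open>proj_inv\<close>, and its average is \<open>c - mean\<close> with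
  \<open>c\<close> the argument on the right-hand side. The single crossing comparison with
  \<open>W = bo_value \<nu> \<phi> n\<close> then gives the claim.\<close>

lemma bo_value_proj_inv_step:
  assumes "C-lipschitz_on UNIV \<phi>" and "convex_on UNIV \<phi>"
  shows "(\<integral>d. bo_value \<nu> \<phi> n (proj_inv \<nu> n (max 0 (i - d) + q 0) (\<lambda>r. q (Suc r)) + n * mean) \<partial>\<nu>)
    \<le> bo_value \<nu> \<phi> (Suc n) (proj_inv \<nu> (Suc n) i q + Suc n * mean)"
proof -
  let ?a = "\<lambda>d. proj_inv \<nu> n (max 0 (i - d) + q 0) (\<lambda>r. q (Suc r)) + n * mean"
  have "(\<integral>d. ?a d \<partial>\<nu>) = proj_inv \<nu> (Suc n) i q + Suc n * mean - mean"
    by (subst Bochner_Integration.integral_add[OF proj_inv_step_integrable])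
      (simp_all add: prob_space[simplified] distrib_right)
  moreover have "antimono ?a"
    by (auto intro!: antimonoI proj_inv_mono)
  moreover have "1-lipschitz_on UNIV ?a"
    using lipschitz_on_add[OF proj_inv_step_lipschitz lipschitz_on_constant] by simp
  ultimately show ?thesis
    using convex_integral_le_of_single_crossing[OF bo_value_convex[OF assms(1,2)]
        bo_value_lipschitz[OF assms(1)], of ?a]
    by simp
qed

end

subsection \<open>Demand history\<close>

locale iid_demand = prob_space M for M :: "'a measure" +
  fixes D :: "'a proc"
  assumes indep: "indep_vars (\<lambda>_. borel) D UNIV"
    and ident: "\<And>s. distr M borel (D s) = distr M borel (D 0)"
    and nonneg: "\<And>s. AE \<omega> in M. 0 \<le> D s \<omega>"
    and integrable_demand: "\<And>s. integrable M (D s)"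
begin

abbreviation law :: "real measure" where
  "law \<equiv> distr M borel (D 0)"

text \<open>The information available before the demand of period \<open>k\<close>. The initial
  state is deterministic, so the state of either system in period \<open>k\<close> turns out to be a
  function of these demands.\<close>

definition hist :: "nat \<Rightarrow> 'a measure" where
  "hist k = vimage_algebra (space M) (\<lambda>\<omega>. \<lambda>i\<in>{..<k}. D i \<omega>) (Pi\<^sub>M {..<k} (\<lambda>_. borel))"

lemma measurable_demand [measurable]: "D s \<in> borel_measurable M"
  using integrable_demand by auto

sublocale demand: demand_law law
  by (intro demand_law.intro real_distribution_distr demand_law_axioms.intro)
    (simp_all add: integrable_distr_eq integrable_demand)

lemma space_hist [simp]: "space (hist k) = space M"
  by (simp add: hist_def)

lemma measurable_hist_demand:
  assumes "j < k" shows "D j \<in> borel_measurable (hist k)"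
proof -
  have "(\<lambda>\<omega>. \<lambda>i\<in>{..<k}. D i \<omega>) \<in> measurable (hist k) (Pi\<^sub>M {..<k} (\<lambda>_. borel))"
    unfolding hist_def by (rule measurable_vimage_algebra1) (auto simp: space_PiM)
  from measurable_compose[OF this measurable_component_singleton[of j]] show ?thesis
    using assms by simp
qed

lemma sets_hist_subset:
  assumes "space N = space M" and "\<And>j. j < k \<Longrightarrow> D j \<in> borel_measurable N"
  shows "sets (hist k) \<subseteq> sets N"
  unfolding hist_def using assms by (intro sets_image_in_sets measurable_restrict) auto

lemma subalgebra_hist: "subalgebra M (hist k)"
  unfolding subalgebra_def using sets_hist_subset[of M k] by simp

lemma subalgebra_hist_mono: "j \<le> k \<Longrightarrow> subalgebra (hist k) (hist j)"
  unfolding subalgebra_def using sets_hist_subset[of "hist k" j] measurable_hist_demand by simp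

text \<open>Before the first demand nothing is random; this later turns a bound on a mean into an
  almost sure bound in period 0.\<close>

lemma sets_hist_0: "A \<in> sets (hist 0) \<Longrightarrow> A = {} \<or> A = space M"
  unfolding hist_def by (subst (asm) sets_vimage_algebra2) (auto simp: space_PiM sets_PiM_empty)

text \<open>The index blocks \<open>{..<k}\<close> and \<open>{k}\<close> are disjoint, so the
  restricted families are independent. The set \<open>?B'\<close> merely rewrites the event on
  \<open>D k\<close> as an event on a one-coordinate family.\<close>

lemma indep_hist_demand:
  assumes "A \<in> sets (hist k)" and [measurable]: "B \<in> sets borel"
  shows "prob (A \<inter> (D k -` B \<inter> space M)) = prob A * prob (D k -` B \<inter> space M)"
proof -
  let ?R = "\<lambda>\<omega>. \<lambda>i\<in>{..<k}. D i \<omega>" and ?S = "\<lambda>\<omega>. \<lambda>i\<in>{k}. D i \<omega>"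
  obtain A' where A': "A' \<in> sets (Pi\<^sub>M {..<k} (\<lambda>_. borel))" "A = ?R -` A' \<inter> space M"
    using assms(1) unfolding hist_def by (subst (asm) sets_vimage_algebra2) (auto simp: space_PiM)
  let ?B' = "{g \<in> space (Pi\<^sub>M {k} (\<lambda>_. borel :: real measure)). g k \<in> B}"
  have B': "?B' \<in> sets (Pi\<^sub>M {k} (\<lambda>_. borel))"
    by measurable
  have "D k -` B \<inter> space M = ?S -` ?B' \<inter> space M"
    by (auto simp: space_PiM)
  moreover have "(\<lambda>\<omega>. (?R \<omega>, ?S \<omega>)) -` (A' \<times> ?B') \<inter> space M = A \<inter> (?S -` ?B' \<inter> space M)"
    using A' by auto
  moreover have "indep_var (Pi\<^sub>M {..<k} (\<lambda>_. borel)) ?R (Pi\<^sub>M {k} (\<lambda>_. borel)) ?S"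
    by (rule indep_var_restrict[OF indep]) auto
  from indep_varD[OF this A'(1) B'] have
    "prob ((\<lambda>\<omega>. (?R \<omega>, ?S \<omega>)) -` (A' \<times> ?B') \<inter> space M) = prob A * prob (?S -` ?B' \<inter> space M)"
    using A'(2) by simp
  ultimately show ?thesis by simp
qed

text \<open>The identity map, viewed as a random variable into \<open>hist k\<close>, is independent
  of \<open>D k\<close>. Their joint distribution is therefore the product \<open>?H\<close> times
  \<open>law\<close>, which is checked on rectangles, and Fubini replaces the demand of period
  \<open>k\<close> by an integration variable.\<close>

lemma
  fixes G :: "'a \<Rightarrow> real \<Rightarrow> real"
  assumes G: "case_prod G \<in> borel_measurable (hist k \<Otimes>\<^sub>M borel)"
    and int: "integrable M (\<lambda>\<omega>. G \<omega> (D k \<omega>))"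
  shows integrable_fresh_demand: "integrable M (\<lambda>\<omega>. \<integral>d. G \<omega> d \<partial>law)"
    and integral_fresh_demand: "(\<integral>\<omega>. G \<omega> (D k \<omega>) \<partial>M) = (\<integral>\<omega>. \<integral>d. G \<omega> d \<partial>law \<partial>M)"
proof -
  let ?H = "distr M (hist k) (\<lambda>\<omega>. \<omega>)"
  note [measurable] = G
  have id: "(\<lambda>\<omega>. \<omega>) \<in> measurable M (hist k)"
    using measurable_from_subalg[OF subalgebra_hist[of k], of "\<lambda>\<omega>. \<omega>" "hist k"] by simp
  then have [measurable]: "(\<lambda>\<omega>. (\<omega>, D k \<omega>)) \<in> measurable M (hist k \<Otimes>\<^sub>M borel)"
    by (rule measurable_Pair) measurable
  have "prob_space ?H" by (rule prob_space_distr[OF id])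
  then interpret pair_sigma_finite ?H law
    by (intro pair_sigma_finite.intro prob_space_imp_sigma_finite demand.prob_space_axioms)
  have eq: "?H \<Otimes>\<^sub>M law = distr M (hist k \<Otimes>\<^sub>M borel) (\<lambda>\<omega>. (\<omega>, D k \<omega>))"
  proof (rule pair_measure_eqI)
    fix A B
    assume A: "A \<in> sets ?H" and B: "B \<in> sets law"
    then have [measurable]: "A \<in> sets (hist k)" "A \<in> sets M" "B \<in> sets borel"
      using subalgebra_hist[of k] by (auto simp: subalgebra_def)
    have "emeasure law B = emeasure (distr M borel (D k)) B"
      using ident[of k] by simp
    moreover have "(\<lambda>\<omega>. (\<omega>, D k \<omega>)) -` (A \<times> B) \<inter> space M = A \<inter> (D k -` B \<inter> space M)"
      using sets.sets_into_space[OF \<open>A \<in> sets M\<close>] by auto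
    moreover have "A \<inter> space M = A"
      using sets.sets_into_space[OF \<open>A \<in> sets M\<close>] by auto
    ultimately show "emeasure ?H A * emeasure law B
        = emeasure (distr M (hist k \<Otimes>\<^sub>M borel) (\<lambda>\<omega>. (\<omega>, D k \<omega>))) (A \<times> B)"
      using indep_hist_demand[of A k B]
      by (simp add: id emeasure_distr emeasure_eq_measure ennreal_mult[symmetric])
  qed (unfold_locales, auto)
  have "integrable (?H \<Otimes>\<^sub>M law) (case_prod G)"
    unfolding eq using int by (simp add: integrable_distr_eq)
  from integrable_fst'[OF this] integral_fst'[OF this]
  have 1: "integrable ?H (\<lambda>\<omega>. \<integral>d. G \<omega> d \<partial>law)"
    and 2: "(\<integral>\<omega>. \<integral>d. G \<omega> d \<partial>law \<partial>?H) = (\<integral>p. case_prod G p \<partial>(?H \<Otimes>\<^sub>M law))"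
    by auto
  have mble: "(\<lambda>\<omega>. \<integral>d. G \<omega> d \<partial>law) \<in> borel_measurable (hist k)"
    by (rule demand.borel_measurable_lebesgue_integral) measurable
  show "integrable M (\<lambda>\<omega>. \<integral>d. G \<omega> d \<partial>law)"
    using 1 by (subst (asm) integrable_distr_eq[OF id mble])
  have "(\<integral>\<omega>. G \<omega> (D k \<omega>) \<partial>M) = (\<integral>p. case_prod G p \<partial>(?H \<Otimes>\<^sub>M law))"
    unfolding eq by (subst integral_distr) auto
  also have "\<dots> = (\<integral>\<omega>. \<integral>d. G \<omega> d \<partial>law \<partial>M)"
    unfolding 2[symmetric] by (rule integral_distr[OF id mble])
  finally show "(\<integral>\<omega>. G \<omega> (D k \<omega>) \<partial>M) = (\<integral>\<omega>. \<integral>d. G \<omega> d \<partial>law \<partial>M)" .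
qed

lemma set_integral_fresh_demand:
  assumes "A \<in> sets (hist k)" and "k \<le> j"
  shows "(\<integral>\<omega>\<in>A. D j \<omega> \<partial>M) = (\<integral>\<omega>\<in>A. demand.mean \<partial>M)"
proof -
  have A [measurable]: "A \<in> sets (hist j)" "A \<in> sets M"
    using assms subalgebra_hist_mono[of k j] subalgebra_hist[of j] by (auto simp: subalgebra_def)
  have "(\<integral>\<omega>. indicator A \<omega> * D j \<omega> \<partial>M) = (\<integral>\<omega>. \<integral>d. indicator A \<omega> * d \<partial>law \<partial>M)"
    by (rule integral_fresh_demand) (auto intro!: integrable_mult_indicator[where 'b=real, simplified] integrable_demand)
  then show ?thesis
    by (simp add: set_lebesgue_integral_def)
qed

text \<open>Each level of the recursion is undone by \<open>integral_fresh_demand\<close>, which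
  puts the actual demand in place of the integration variable. The new argument
  \<open>X - D k\<close> is known one period later, so the induction continues from
  \<open>Suc k\<close>.\<close>

lemma integral_bo_value:
  assumes \<phi>: "C-lipschitz_on UNIV \<phi>" and "integrable M X" and "X \<in> borel_measurable (hist k)"
  shows "(\<integral>\<omega>. bo_value law \<phi> n (X \<omega>) \<partial>M) = (\<integral>\<omega>. \<phi> (X \<omega> - (\<Sum>i<n. D (k + i) \<omega>)) \<partial>M)"
  using assms(2,3)
proof (induction n arbitrary: k X)
  case (Suc n)
  note [measurable] = Suc.prems(2)
  note lip = demand.bo_value_lipschitz[OF \<phi>, of n]
  have [measurable]: "bo_value law \<phi> n \<in> borel_measurable borel"
    by (rule borel_measurable_continuous_onI[OF lipschitz_on_continuous_on[OF lip]])
  have [measurable]: "X \<in> borel_measurable (hist (Suc k))" "D k \<in> borel_measurable (hist (Suc k))"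
    using measurable_from_subalg[OF subalgebra_hist_mono Suc.prems(2)]
    by (auto intro: measurable_hist_demand)
  have int: "integrable M (\<lambda>\<omega>. X \<omega> - D k \<omega>)"
    using Suc.prems(1) integrable_demand by auto
  have "(\<integral>\<omega>. bo_value law \<phi> (Suc n) (X \<omega>) \<partial>M) = (\<integral>\<omega>. bo_value law \<phi> n (X \<omega> - D k \<omega>) \<partial>M)"
    unfolding bo_value.simps
    by (rule integral_fresh_demand[symmetric])
      (use integrable_compose_lipschitz[OF lip int] in measurable)
  also have "\<dots> = (\<integral>\<omega>. \<phi> (X \<omega> - D k \<omega> - (\<Sum>i<n. D (Suc k + i) \<omega>)) \<partial>M)"
    by (rule Suc.IH[OF int]) measurable
  also have "(\<lambda>\<omega>. X \<omega> - D k \<omega> - (\<Sum>i<n. D (Suc k + i) \<omega>))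
      = (\<lambda>\<omega>. X \<omega> - (\<Sum>i<Suc n. D (k + i) \<omega>))"
    by (simp add: sum.lessThan_Suc_shift diff_diff_eq del: sum.lessThan_Suc)
  finally show ?case by simp
qed simp

end

subsection \<open>Measurability of the inventory process\<close>

text \<open>Common structure of the two systems: \<open>f\<close> is the positive part under lost
  sales and the identity under back-orders, and \<open>Y\<close> is the (net) inventory before the
  arriving order is added.\<close>

locale inventory_system = iid_demand M D for M :: "'a measure" and D +
  fixes \<tau> :: nat and x :: "nat \<Rightarrow> real" and f :: "real \<Rightarrow> real" and Y I q :: "'a proc"
  assumes measurable_f: "f \<in> borel_measurable borel"
    and Y_0: "Y 0 \<omega> = x 0"
    and Y_Suc: "Y (Suc t) \<omega> = f (I t \<omega> - D t \<omega>)"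
    and I_0: "I 0 \<omega> = (if \<tau> = 0 then x 0 + q 0 \<omega> else x 0)"
    and I_Suc: "I (Suc t) \<omega> = Y (Suc t) \<omega> + q (Suc t) \<omega>"
    and pipeline: "initial_pipeline M \<tau> x q"
    and order: "q (t + \<tau>) \<in> borel_measurable (state_algebra M \<tau> (sys_state \<tau> Y I q t))"
begin

abbreviation state :: "nat \<Rightarrow> 'a measure" where
  "state t \<equiv> state_algebra M \<tau> (sys_state \<tau> Y I q t)"

lemma I_eq: "\<tau> = 0 \<or> 0 < t \<Longrightarrow> I t \<omega> = Y t \<omega> + q t \<omega>"
  by (cases t) (auto simp: I_0 Y_0 I_Suc)

lemma space_state [simp]: "space (state t) = space M"
  by (simp add: state_algebra_def)

lemma measurable_state_component:
  assumes "i < max 1 \<tau>"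
  shows "(\<lambda>\<omega>. if i = 0 then (if \<tau> = 0 then Y t \<omega> else I t \<omega>) else q (t + i) \<omega>)
    \<in> borel_measurable (state t)"
proof -
  have "sys_state \<tau> Y I q t \<in> measurable (state t) (Pi\<^sub>M {..<max 1 \<tau>} (\<lambda>_. borel))"
    unfolding state_algebra_def
    by (rule measurable_vimage_algebra1) (auto simp: space_PiM sys_state_def)
  from measurable_compose[OF this measurable_component_singleton[of i]] show ?thesis
    using assms by (simp add: sys_state_def)
qed

lemma measurable_state_order:
  assumes "i \<le> \<tau>" and "0 < i \<or> \<tau> = 0"
  shows "q (t + i) \<in> borel_measurable (state t)"
  using order[of t] measurable_state_component[of i t] assms by (cases "i = \<tau>") auto

lemma measurable_state_inventory: "I t \<in> borel_measurable (state t)"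
proof (cases "\<tau> = 0")
  case True
  have "(\<lambda>\<omega>. Y t \<omega> + q t \<omega>) \<in> borel_measurable (state t)"
    using measurable_state_component[of 0 t] measurable_state_order[of 0 t] True by simp
  then show ?thesis
    using I_eq True by (metis (no_types, lifting) ext)
next
  case False
  then show ?thesis using measurable_state_component[of 0 t] by simp
qed

text \<open>Inventories and orders determine each other recursively, so the three claims rest on one
  induction: a known state makes the order placed in that period known, and this order together with
  the next demand makes the next state known.\<close>

lemma system_adapted:
  shows "subalgebra (hist t) (state t)" and "I t \<in> borel_measurable (hist t)"
    and "0 < i \<Longrightarrow> i \<le> t + \<tau> \<Longrightarrow> q i \<in> borel_measurable (hist t)"
proof -
  \<comment> \<open>This describes the moment before the order of period \<open>t\<close> is placed,
    hence the strict bound \<open>i < t + \<tau>\<close>. For \<open>\<tau> = 0\<close> the level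
    \<open>I t\<close> already contains that order, so \<open>Y t\<close> takes its place.\<close>
  define known where "known t \<longleftrightarrow> (if \<tau> = 0 then Y t else I t) \<in> borel_measurable (hist t) \<and>
      (\<forall>i. 0 < i \<and> i < t + \<tau> \<longrightarrow> q i \<in> borel_measurable (hist t))" for t
  have sub: "subalgebra (hist t) (state t)" if "known t" for t
  proof -
    have "sys_state \<tau> Y I q t \<in> measurable (hist t) (Pi\<^sub>M {..<max 1 \<tau>} (\<lambda>_. borel))"
      unfolding sys_state_def
    proof (rule measurable_restrict)
      fix i
      assume "i \<in> {..<max 1 \<tau>}"
      then show "(\<lambda>\<omega>. if i = 0 then (if \<tau> = 0 then Y t \<omega> else I t \<omega>) else q (t + i) \<omega>)
          \<in> borel_measurable (hist t)"
        using that by (cases "i = 0"; cases "\<tau> = 0") (auto simp: known_def)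
    qed
    then have "sets (state t) \<subseteq> sets (hist t)"
      unfolding state_algebra_def by (intro sets_image_in_sets) auto
    then show ?thesis by (simp add: subalgebra_def)
  qed
  have q: "q i \<in> borel_measurable (hist t)" if "known t" "0 < i" "i \<le> t + \<tau>" for t i
  proof (cases "i = t + \<tau>")
    case True
    then show ?thesis using measurable_from_subalg[OF sub[OF that(1)] order] by simp
  next
    case False
    then show ?thesis using that by (auto simp: known_def)
  qed
  have "known t"
  proof (induction t)
    case 0
    have "q i \<in> borel_measurable (hist 0)" if "0 < i" "i < \<tau>" for i
    proof -
      have "q i \<in> borel_measurable (hist 0) \<longleftrightarrow> (\<lambda>_. x i) \<in> borel_measurable (hist 0)"
        using pipeline that by (intro measurable_cong) (auto simp: initial_pipeline_def)
      then show ?thesis by simp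
    qed
    moreover have "Y 0 = (\<lambda>_. x 0)" and "\<tau> \<noteq> 0 \<Longrightarrow> I 0 = (\<lambda>_. x 0)"
      by (auto simp: Y_0 I_0)
    ultimately show ?case by (auto simp: known_def)
  next
    case (Suc t)
    have hist_Suc: "g \<in> borel_measurable (hist (Suc t))" if "g \<in> borel_measurable (hist t)" for g :: "'a \<Rightarrow> real"
      using measurable_from_subalg[OF subalgebra_hist_mono that] by simp
    have "I t \<in> borel_measurable (hist (Suc t))"
      by (rule hist_Suc[OF measurable_from_subalg[OF sub[OF Suc] measurable_state_inventory]])
    then have "(\<lambda>\<omega>. f (I t \<omega> - D t \<omega>)) \<in> borel_measurable (hist (Suc t))"
      by (intro measurable_compose[OF _ measurable_f] borel_measurable_diff measurable_hist_demand) auto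
    then have Y: "Y (Suc t) \<in> borel_measurable (hist (Suc t))"
      by (simp add: Y_Suc[abs_def])
    have q': "q i \<in> borel_measurable (hist (Suc t))" if "0 < i" "i \<le> t + \<tau>" for i
      by (rule hist_Suc[OF q[OF Suc that]])
    \<comment> \<open>With a positive lead time the order arriving in period \<open>Suc t\<close>
      was placed in period \<open>t\<close> at the latest.\<close>
    then have "(\<lambda>\<omega>. Y (Suc t) \<omega> + q (Suc t) \<omega>) \<in> borel_measurable (hist (Suc t))" if "\<tau> \<noteq> 0"
      using that Y by (intro borel_measurable_add) auto
    then show ?case
      using q' Y by (auto simp: known_def I_Suc[abs_def])
  qed
  then show "subalgebra (hist t) (state t)" and "I t \<in> borel_measurable (hist t)"
    and "0 < i \<Longrightarrow> i \<le> t + \<tau> \<Longrightarrow> q i \<in> borel_measurable (hist t)"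
    using sub measurable_from_subalg[OF sub measurable_state_inventory] q by auto
qed

lemma subalgebra_state: "subalgebra M (state t)"
  using subalgebra_hist[of t] system_adapted(1)[of t] by (auto simp: subalgebra_def)

lemma sigma_finite_subalgebra_state: "sigma_finite_subalgebra M (state t)"
  by (intro finite_measure_subalgebra_is_sigma_finite finite_measure_subalgebra.intro
      finite_measure_axioms finite_measure_subalgebra_axioms.intro subalgebra_state)

lemma measurable_inventory [measurable]: "I t \<in> borel_measurable M"
  by (rule measurable_from_subalg[OF subalgebra_state measurable_state_inventory])

lemma measurable_order [measurable]: "q (t + \<tau>) \<in> borel_measurable M"
  by (rule measurable_from_subalg[OF subalgebra_state order])

lemma sets_state_hist: "A \<in> sets (state t) \<Longrightarrow> A \<in> sets (hist t)"
  using system_adapted(1)[of t] by (auto simp: subalgebra_def)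

lemma sets_state: "A \<in> sets (state t) \<Longrightarrow> A \<in> sets M"
  using subalgebra_state[of t] by (auto simp: subalgebra_def)

end

subsection \<open>The two policies\<close>

locale lost_sales_PIL = iid_demand M D for M :: "'a measure" and D +
  fixes \<tau> :: nat and x :: "nat \<Rightarrow> real" and U :: real and q :: "'a proc"
  assumes initial_nonneg: "\<And>i. i < max 1 \<tau> \<Longrightarrow> 0 \<le> x i"
    and pipeline: "initial_pipeline M \<tau> x q"
    and policy: "ls_PIL M \<tau> x D U q"
    and attainable: "(\<integral>\<omega>. ls_prev \<tau> x D q \<tau> \<omega> \<partial>M) \<le> U"
begin

abbreviation I :: "'a proc" where "I \<equiv> ls_I \<tau> x D q"

abbreviation Y :: "'a proc" where "Y \<equiv> ls_prev \<tau> x D q"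

sublocale inventory_system M D \<tau> x "max 0" Y I q
proof
  show "q (t + \<tau>) \<in> borel_measurable (state_algebra M \<tau> (sys_state \<tau> Y I q t))" for t
    using policy by (simp add: ls_PIL_def ls_algebra_def)
qed (simp_all add: ls_prev_def ls_J_def pipeline)

lemma AE_order: "AE \<omega> in M. q (t + \<tau>) \<omega> = max 0 (U - real_cond_exp M (state t) (Y (t + \<tau>)) \<omega>)"
  using policy by (simp add: ls_PIL_def ls_algebra_def)

lemma prev_nonneg: "0 \<le> Y t \<omega>"
  using initial_nonneg[of 0] by (cases t) (auto simp: ls_prev_def ls_J_def)

lemma measurable_prev [measurable]: "Y t \<in> borel_measurable M"
proof (cases t)
  case 0
  then show ?thesis by (simp add: ls_prev_def)
next
  case (Suc s)
  have "(\<lambda>\<omega>. max 0 (I s \<omega> - D s \<omega>)) \<in> borel_measurable M"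
    by measurable
  then show ?thesis by (simp add: Suc Y_Suc[abs_def])
qed

text \<open>Inventory is nonnegative, hence so is its conditional mean, and an order never exceeds
  the positive part of \<open>U\<close>. Boundedness then yields integrability of the
  orders.\<close>

lemma AE_order_bounds: "AE \<omega> in M. 0 \<le> q (t + \<tau>) \<omega> \<and> q (t + \<tau>) \<omega> \<le> max 0 U"
proof -
  interpret sigma_finite_subalgebra M "state t"
    by (rule sigma_finite_subalgebra_state)
  have "AE \<omega> in M. 0 \<le> real_cond_exp M (state t) (Y (t + \<tau>)) \<omega>"
    by (rule real_cond_exp_pos) (auto simp: prev_nonneg)
  then show ?thesis
    using AE_order[of t] by eventually_elim auto
qed

lemma
  assumes "0 < i \<or> \<tau> = 0"
  shows AE_order_nonneg: "AE \<omega> in M. 0 \<le> q i \<omega>" and integrable_order: "integrable M (q i)"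
proof -
  have "(AE \<omega> in M. 0 \<le> q i \<omega>) \<and> integrable M (q i)"
  proof (cases "i < \<tau>")
    case True
    then have *: "\<omega> \<in> space M \<Longrightarrow> q i \<omega> = x i" for \<omega>
      using pipeline assms by (auto simp: initial_pipeline_def)
    then have "integrable M (q i) \<longleftrightarrow> integrable M (\<lambda>_. x i)"
      by (intro Bochner_Integration.integrable_cong) auto
    then show ?thesis
      using * initial_nonneg[of i] True by (auto intro!: AE_I2)
  next
    case False
    then obtain t where i: "i = t + \<tau>"
      by (metis add.commute le_add_diff_inverse not_less)
    have "integrable M (q i)"
      unfolding i using AE_order_bounds[of t]
      by (intro integrable_const_bound[where B = "max 0 U"]) auto
    moreover have "AE \<omega> in M. 0 \<le> q i \<omega>"
      unfolding i using AE_order_bounds[of t] by eventually_elim auto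
    ultimately show ?thesis by simp
  qed
  then show "AE \<omega> in M. 0 \<le> q i \<omega>" "integrable M (q i)" by auto
qed

lemma AE_inventory_nonneg: "AE \<omega> in M. 0 \<le> I t \<omega>"
proof (cases "\<tau> = 0 \<or> 0 < t")
  case True
  then have "AE \<omega> in M. 0 \<le> q t \<omega>"
    by (intro AE_order_nonneg) auto
  then show ?thesis
    using True I_eq[of t] prev_nonneg[of t] by (auto elim!: eventually_mono)
next
  case False
  then show ?thesis using initial_nonneg[of 0] by (simp add: I_0)
qed

lemma integrable_inventory: "integrable M (I t)"
proof (induction t)
  case 0
  show ?case
    using integrable_order[of 0] by (cases "\<tau> = 0") (simp_all add: I_0[abs_def])
next
  case (Suc t)
  then have "integrable M (\<lambda>\<omega>. max 0 (I t \<omega> - D t \<omega>) + q (Suc t) \<omega>)"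
    using integrable_order[of "Suc t"] integrable_demand[of t] by simp
  then show ?case by simp
qed

text \<open>For \<open>n <= \<tau>\<close> every order used here has been placed by period
  \<open>k\<close>. By \<open>integral_indicator_proj\<close> it has the same integral as
  \<open>I (k + n)\<close> over each event of \<open>hist k\<close>.\<close>

definition proj :: "nat \<Rightarrow> 'a proc" where
  "proj n k \<omega> = proj_inv law n (I k \<omega>) (\<lambda>r. q (Suc (k + r)) \<omega>)"

text \<open>The projection made one period later, with the demand of period \<open>k\<close> kept as
  a free variable \<open>d\<close>, in the form required by
  \<open>integral_fresh_demand\<close>.\<close>

definition proj_step :: "nat \<Rightarrow> nat \<Rightarrow> 'a \<Rightarrow> real \<Rightarrow> real" where
  "proj_step n k \<omega> d =
     proj_inv law n (max 0 (I k \<omega> - d) + q (Suc k) \<omega>) (\<lambda>r. q (Suc (Suc k + r)) \<omega>)"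

lemma proj_0 [simp]: "proj 0 k = I k"
  by (simp add: proj_def fun_eq_iff)

lemma proj_Suc: "proj (Suc n) k \<omega> = (\<integral>d. proj_step n k \<omega> d \<partial>law)"
  by (simp add: proj_def proj_step_def)

lemma proj_step_demand: "proj_step n k \<omega> (D k \<omega>) = proj n (Suc k) \<omega>"
  by (simp add: proj_def proj_step_def)

lemma measurable_proj_step:
  assumes "Suc n \<le> \<tau>"
  shows "case_prod (proj_step n k) \<in> borel_measurable (hist k \<Otimes>\<^sub>M borel)"
proof -
  have [measurable]: "q (Suc k) \<in> borel_measurable (hist k)" "I k \<in> borel_measurable (hist k)"
    using assms system_adapted by auto
  have "(\<lambda>p. proj_inv law n (max 0 (I k (fst p) - snd p) + q (Suc k) (fst p))
      (\<lambda>r. q (Suc (Suc k + r)) (fst p))) \<in> borel_measurable (hist k \<Otimes>\<^sub>M borel)"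
  proof (rule demand.measurable_proj_inv)
    show "(\<lambda>p. max 0 (I k (fst p) - snd p) + q (Suc k) (fst p)) \<in> borel_measurable (hist k \<Otimes>\<^sub>M borel)"
      by measurable
    show "(\<lambda>p. q (Suc (Suc k + r)) (fst p)) \<in> borel_measurable (hist k \<Otimes>\<^sub>M borel)" if "r < n" for r
      using that assms by (intro measurable_compose[OF measurable_fst] system_adapted(3)) auto
  qed
  then show ?thesis
    by (simp add: proj_step_def case_prod_beta')
qed

lemma integrable_proj: "n \<le> \<tau> \<Longrightarrow> integrable M (proj n k)"
proof (induction n arbitrary: k)
  case (Suc n)
  then have "integrable M (\<lambda>\<omega>. proj_step n k \<omega> (D k \<omega>))"
    by (simp add: proj_step_demand[abs_def])
  from integrable_fresh_demand[OF measurable_proj_step[OF Suc.prems] this] show ?case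
    by (simp add: proj_Suc[abs_def])
qed (simp add: integrable_inventory)

text \<open>This is the tower property: the outermost integral of the recursion is exchanged for the
  actual demand \<open>D k\<close>, and \<open>A\<close> still belongs to the larger
  \<open>hist (Suc k)\<close>, where the induction hypothesis applies.\<close>

lemma integral_indicator_proj:
  "n \<le> \<tau> \<Longrightarrow> A \<in> sets (hist k) \<Longrightarrow>
    (\<integral>\<omega>. indicator A \<omega> * proj n k \<omega> \<partial>M) = (\<integral>\<omega>. indicator A \<omega> * I (k + n) \<omega> \<partial>M)"
proof (induction n arbitrary: k)
  case (Suc n)
  note [measurable] = measurable_proj_step[OF Suc.prems(1), of k] Suc.prems(2)
  have A: "A \<in> sets (hist (Suc k))" "A \<in> sets M"
    using Suc.prems(2) subalgebra_hist_mono[of k "Suc k"] subalgebra_hist[of k]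
    by (auto simp: subalgebra_def)
  have "(\<integral>\<omega>. indicator A \<omega> * proj (Suc n) k \<omega> \<partial>M)
      = (\<integral>\<omega>. \<integral>d. indicator A \<omega> * proj_step n k \<omega> d \<partial>law \<partial>M)"
    by (simp add: proj_Suc)
  also have "\<dots> = (\<integral>\<omega>. indicator A \<omega> * proj_step n k \<omega> (D k \<omega>) \<partial>M)"
  proof (rule integral_fresh_demand[symmetric])
    show "(\<lambda>(\<omega>, d). indicator A \<omega> * proj_step n k \<omega> d) \<in> borel_measurable (hist k \<Otimes>\<^sub>M borel)"
      by measurable
    show "integrable M (\<lambda>\<omega>. indicator A \<omega> * proj_step n k \<omega> (D k \<omega>))"
      using integrable_mult_indicator[OF A(2) integrable_proj[of n "Suc k"]] Suc.prems(1)
      by (simp add: proj_step_demand)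
  qed
  also have "\<dots> = (\<integral>\<omega>. indicator A \<omega> * I (k + Suc n) \<omega> \<partial>M)"
    using Suc.IH[OF _ A(1)] Suc.prems(1) by (simp add: proj_step_demand)
  finally show ?case .
qed simp

lemma measurable_state_proj: "proj \<tau> t \<in> borel_measurable (state t)"
proof -
  have "(\<lambda>\<omega>. proj_inv law \<tau> (I t \<omega>) (\<lambda>r. q (Suc (t + r)) \<omega>)) \<in> borel_measurable (state t)"
  proof (rule demand.measurable_proj_inv[OF measurable_state_inventory])
    show "q (Suc (t + r)) \<in> borel_measurable (state t)" if "r < \<tau>" for r
      using measurable_state_order[of "Suc r" t] that by simp
  qed
  then show ?thesis by (simp add: proj_def[abs_def])
qed

lemma prev_eq: "Y (t + \<tau>) \<omega> = I (t + \<tau>) \<omega> - q (t + \<tau>) \<omega>"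
proof -
  have "\<tau> = 0 \<or> 0 < t + \<tau>" by auto
  from I_eq[OF this] show ?thesis by simp
qed

lemma integrable_policy_order: "integrable M (q (t + \<tau>))"
  by (rule integrable_order) auto

text \<open>The order \<open>q (t + \<tau>)\<close> is a function of the state, so it can be taken
  out of the conditional expectation of \<open>I (t + \<tau>)\<close>, whose version is
  \<open>proj \<tau> t\<close>.\<close>

lemma AE_cond_exp_prev:
  "AE \<omega> in M. real_cond_exp M (state t) (Y (t + \<tau>)) \<omega> = proj \<tau> t \<omega> - q (t + \<tau>) \<omega>"
proof -
  interpret sigma_finite_subalgebra M "state t"
    by (rule sigma_finite_subalgebra_state)
  have Y: "Y (t + \<tau>) = (\<lambda>\<omega>. I (t + \<tau>) \<omega> - q (t + \<tau>) \<omega>)"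
    by (simp add: prev_eq fun_eq_iff)
  show ?thesis
  proof (rule real_cond_exp_charact)
    fix A assume A: "A \<in> sets (state t)"
    have int: "integrable M (\<lambda>\<omega>. indicator A \<omega> * g \<omega>)" if "integrable M g" for g :: "'a \<Rightarrow> real"
      using integrable_mult_indicator[OF sets_state[OF A] that] by simp
    show "(\<integral>\<omega>\<in>A. Y (t + \<tau>) \<omega> \<partial>M) = (\<integral>\<omega>\<in>A. proj \<tau> t \<omega> - q (t + \<tau>) \<omega> \<partial>M)"
      using integral_indicator_proj[OF order_refl sets_state_hist[OF A]]
      by (simp add: Y set_lebesgue_integral_def right_diff_distrib int integrable_inventory
          integrable_policy_order integrable_proj)
  qed (auto simp: Y integrable_inventory integrable_policy_order integrable_proj
      intro!: borel_measurable_diff measurable_state_proj order)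
qed

lemma integral_proj_minus_order:
  "(\<integral>\<omega>. proj \<tau> t \<omega> - q (t + \<tau>) \<omega> \<partial>M) = (\<integral>\<omega>. Y (t + \<tau>) \<omega> \<partial>M)"
proof -
  have "(\<integral>\<omega>. indicator (space M) \<omega> * proj \<tau> t \<omega> \<partial>M) = (\<integral>\<omega>. indicator (space M) \<omega> * I (t + \<tau>) \<omega> \<partial>M)"
    using integral_indicator_proj[of \<tau> "space M" t] sets.top[of "hist t"] by simp
  then have "(\<integral>\<omega>. proj \<tau> t \<omega> \<partial>M) = (\<integral>\<omega>. I (t + \<tau>) \<omega> \<partial>M)"
    by (simp cong: Bochner_Integration.integral_cong)
  then show ?thesis
    by (simp add: prev_eq integrable_inventory integrable_policy_order integrable_proj)
qed

text \<open>Since \<open>hist 0\<close> is trivial, the event that the level exceeds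
  \<open>U\<close> is empty or the whole space. The second case would push the mean above
  \<open>U\<close>, against attainability.\<close>

lemma AE_proj_minus_order_le_0: "AE \<omega> in M. proj \<tau> 0 \<omega> - q \<tau> \<omega> \<le> U"
proof -
  let ?g = "\<lambda>\<omega>. proj \<tau> 0 \<omega> - q \<tau> \<omega>"
  have [measurable]: "?g \<in> borel_measurable (hist 0)"
    using measurable_from_subalg[OF system_adapted(1)[of 0] measurable_state_proj[of 0]]
      measurable_from_subalg[OF system_adapted(1)[of 0] order[of 0]] by simp
  have "{\<omega> \<in> space (hist 0). U < ?g \<omega>} \<in> sets (hist 0)"
    by measurable
  from sets_hist_0[OF this] show ?thesis
  proof
    assume "{\<omega> \<in> space (hist 0). U < ?g \<omega>} = {}"
    then show ?thesis by (intro AE_I2) (auto simp: not_less)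
  next
    assume "{\<omega> \<in> space (hist 0). U < ?g \<omega>} = space M"
    then have "AE \<omega> in M. U < ?g \<omega>"
      by (intro AE_I2) auto
    from expectation_greater[OF _ this] have "U < (\<integral>\<omega>. ?g \<omega> \<partial>M)"
      using integrable_proj[of \<tau> 0] integrable_policy_order[of 0] by simp
    then show ?thesis
      using integral_proj_minus_order[of 0] attainable by simp
  qed
qed

text \<open>Under the assumption the positive part in the policy is inactive, so the order exactly
  fills the gap up to \<open>U\<close>.\<close>

lemma AE_proj_eq:
  assumes "AE \<omega> in M. proj \<tau> t \<omega> - q (t + \<tau>) \<omega> \<le> U"
  shows "AE \<omega> in M. proj \<tau> t \<omega> = U"
  using assms AE_order[of t] AE_cond_exp_prev[of t]
proof eventually_elim
  case (elim \<omega>)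
  then show ?case by linarith
qed

text \<open>Attainability propagates: by \<open>AE_proj_eq\<close> it suffices to keep the projected
  level before ordering below \<open>U\<close>, and the induction hypothesis for period
  \<open>t\<close> also passes through \<open>AE_proj_eq\<close> to give equality there.\<close>

lemma AE_proj: "AE \<omega> in M. proj \<tau> t \<omega> = U"
proof (rule AE_proj_eq, induction t)
  case 0
  then show ?case using AE_proj_minus_order_le_0 by simp
next
  case (Suc t)
  have "AE \<omega> in M. \<forall>r. 0 \<le> q (Suc (t + r)) \<omega>"
    unfolding AE_all_countable by (auto intro: AE_order_nonneg)
  then show ?case
    using AE_proj_eq[OF Suc] AE_inventory_nonneg[of t] nonneg[of t]
  proof eventually_elim
    case (elim \<omega>)
    \<comment> \<open>Nonnegative demand and inventory give
      \<open>I (Suc t) <= I t + q (Suc t)\<close>, the invariant of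
      \<open>proj_inv_early_le\<close>. The extra last term is the order placed in period
      \<open>Suc t\<close>.\<close>
    have "proj \<tau> (Suc t) \<omega> \<le> proj \<tau> t \<omega> + q (Suc (t + \<tau>)) \<omega>"
      using demand.proj_inv_early_le[of "I (Suc t) \<omega>" "I t \<omega>" "\<lambda>r. q (Suc (t + r)) \<omega>" \<tau>] elim
      by (auto simp: proj_def)
    then show ?case using elim by simp
  qed
qed

text \<open>Back-order dynamics replace lost sales dynamics period by period, the latest period
  first. The induction hypothesis at \<open>Suc k\<close> covers the last \<open>n\<close> periods;
  period \<open>k\<close> is then handled for fixed \<open>\<omega>\<close> by
  \<open>bo_value_proj_inv_step\<close>, after its demand has been integrated out.\<close>

lemma integral_inventory_le_bo_value:
  assumes "C-lipschitz_on UNIV \<phi>" and "convex_on UNIV \<phi>"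
  shows "n \<le> \<tau> \<Longrightarrow> (\<integral>\<omega>. \<phi> (I (k + n) \<omega>) \<partial>M)
    \<le> (\<integral>\<omega>. bo_value law \<phi> n (proj n k \<omega> + n * demand.mean) \<partial>M)"
proof (induction n arbitrary: k)
  case (Suc n)
  note [measurable] = measurable_proj_step[OF Suc.prems, of k]
  note lip = demand.bo_value_lipschitz[OF assms(1)]
  have [measurable]: "bo_value law \<phi> n \<in> borel_measurable borel"
    by (rule borel_measurable_continuous_onI[OF lipschitz_on_continuous_on[OF lip]])
  have mble: "(\<lambda>(\<omega>, d). bo_value law \<phi> n (proj_step n k \<omega> d + n * demand.mean))
      \<in> borel_measurable (hist k \<Otimes>\<^sub>M borel)"
    by measurable
  have int: "integrable M (\<lambda>\<omega>. bo_value law \<phi> n (proj_step n k \<omega> (D k \<omega>) + n * demand.mean))"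
    unfolding proj_step_demand using Suc.prems
    by (intro integrable_compose_lipschitz[OF lip] Bochner_Integration.integrable_add integrable_proj) auto
  have "(\<integral>\<omega>. \<phi> (I (k + Suc n) \<omega>) \<partial>M)
      \<le> (\<integral>\<omega>. bo_value law \<phi> n (proj_step n k \<omega> (D k \<omega>) + n * demand.mean) \<partial>M)"
    unfolding proj_step_demand using Suc.IH[of "Suc k"] Suc.prems by simp
  also have "\<dots> = (\<integral>\<omega>. \<integral>d. bo_value law \<phi> n (proj_step n k \<omega> d + n * demand.mean) \<partial>law \<partial>M)"
    by (rule integral_fresh_demand[OF mble int])
  also have "\<dots> \<le> (\<integral>\<omega>. bo_value law \<phi> (Suc n) (proj (Suc n) k \<omega> + Suc n * demand.mean) \<partial>M)"
  proof (rule integral_mono)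
    show "integrable M (\<lambda>\<omega>. \<integral>d. bo_value law \<phi> n (proj_step n k \<omega> d + n * demand.mean) \<partial>law)"
      by (rule integrable_fresh_demand[OF mble int])
    show "integrable M (\<lambda>\<omega>. bo_value law \<phi> (Suc n) (proj (Suc n) k \<omega> + Suc n * demand.mean))"
      using Suc.prems
      by (intro integrable_compose_lipschitz[OF lip] Bochner_Integration.integrable_add integrable_proj) auto
    show "(\<integral>d. bo_value law \<phi> n (proj_step n k \<omega> d + n * demand.mean) \<partial>law)
        \<le> bo_value law \<phi> (Suc n) (proj (Suc n) k \<omega> + Suc n * demand.mean)" for \<omega>
      using demand.bo_value_proj_inv_step[OF assms, of n "I k \<omega>" "\<lambda>r. q (Suc (k + r)) \<omega>"]
      by (simp add: proj_step_def proj_def del: bo_value.simps proj_inv.simps)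
  qed
  finally show ?case .
qed simp

lemma integral_inventory_le:
  assumes "C-lipschitz_on UNIV \<phi>" and "convex_on UNIV \<phi>"
  shows "(\<integral>\<omega>. \<phi> (I (t + \<tau>) \<omega>) \<partial>M) \<le> bo_value law \<phi> \<tau> (U + \<tau> * demand.mean)"
proof -
  note lip = demand.bo_value_lipschitz[OF assms(1)]
  have "(\<integral>\<omega>. bo_value law \<phi> \<tau> (proj \<tau> t \<omega> + \<tau> * demand.mean) \<partial>M)
      = (\<integral>\<omega>. bo_value law \<phi> \<tau> (U + \<tau> * demand.mean) \<partial>M)"
  proof (rule integral_cong_AE)
    show "(\<lambda>\<omega>. bo_value law \<phi> \<tau> (proj \<tau> t \<omega> + \<tau> * demand.mean)) \<in> borel_measurable M"
      by (intro borel_measurable_integrable integrable_compose_lipschitz[OF lip]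
          Bochner_Integration.integrable_add integrable_proj) auto
  qed (use AE_proj[of t] in auto)
  then show ?thesis
    using integral_inventory_le_bo_value[OF assms order_refl, of t] by (simp add: prob_space)
qed

end

section \<open>The back-order system under its projected inventory level policy\<close>

locale back_order_PIL = iid_demand M D for M :: "'a measure" and D +
  fixes \<tau> :: nat and x :: "nat \<Rightarrow> real" and U :: real and q :: "'a proc"
  assumes pipeline: "initial_pipeline M \<tau> x q" and policy: "bo_PIL M \<tau> x D U q"
begin

abbreviation I :: "'a proc" where "I \<equiv> bo_I \<tau> x D q"

abbreviation Y :: "'a proc" where "Y \<equiv> bo_prev \<tau> x D q"

sublocale inventory_system M D \<tau> x "\<lambda>y. y" Y I q
proof
  show "q (t + \<tau>) \<in> borel_measurable (state_algebra M \<tau> (sys_state \<tau> Y I q t))" for t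
    using policy by (simp add: bo_PIL_def bo_algebra_def)
qed (simp_all add: bo_prev_def pipeline)

text \<open>The inventory position just after the order of period \<open>s\<close> has been placed;
  \<open>AE_position\<close> identifies it with the base-stock level.\<close>

definition position :: "'a proc" where
  "position s \<omega> = I s \<omega> + (\<Sum>i<\<tau>. q (Suc (s + i)) \<omega>)"

lemma inventory_eq_sum:
  "I (s + n) \<omega> = I s \<omega> + (\<Sum>i<n. q (Suc (s + i)) \<omega>) - (\<Sum>i<n. D (s + i) \<omega>)"
  by (induction n) auto

lemma inventory_eq: "I (s + \<tau>) \<omega> = position s \<omega> - (\<Sum>i<\<tau>. D (s + i) \<omega>)"
  by (simp add: inventory_eq_sum position_def)

lemma integrable_inventory: "integrable M (I (s + \<tau>))"
  using policy by (simp add: bo_PIL_def)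

text \<open>The position is a function of the state, while the demands of periods \<open>s\<close>
  to \<open>s + \<tau> - 1\<close> are independent of it. The conditional mean of
  \<open>I (s + \<tau>)\<close> is thus the position minus the mean lead time demand, and the policy
  sets it to \<open>U\<close>.\<close>

lemma AE_position: "AE \<omega> in M. position s \<omega> = U + \<tau> * demand.mean"
proof -
  interpret sigma_finite_subalgebra M "state s"
    by (rule sigma_finite_subalgebra_state)
  have eq: "position s = (\<lambda>\<omega>. I (s + \<tau>) \<omega> + (\<Sum>i<\<tau>. D (s + i) \<omega>))"
    by (simp add: inventory_eq fun_eq_iff)
  have int_pos: "integrable M (position s)"
    unfolding eq by (intro Bochner_Integration.integrable_add integrable_inventory
        Bochner_Integration.integrable_sum integrable_demand)
  have "AE \<omega> in M. real_cond_exp M (state s) (I (s + \<tau>)) \<omega> = position s \<omega> - \<tau> * demand.mean"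
  proof (rule real_cond_exp_charact)
    fix A assume A: "A \<in> sets (state s)"
    have int: "integrable M (\<lambda>\<omega>. indicator A \<omega> * g \<omega>)" if "integrable M g" for g :: "'a \<Rightarrow> real"
      using integrable_mult_indicator[OF sets_state[OF A] that] by simp
    define S where "S \<omega> = (\<Sum>i<\<tau>. D (s + i) \<omega>)" for \<omega>
    have int_S: "integrable M S"
      unfolding S_def[abs_def] by (intro Bochner_Integration.integrable_sum integrable_demand)
    have "(\<integral>\<omega>. indicator A \<omega> * S \<omega> \<partial>M) = (\<Sum>i<\<tau>. \<integral>\<omega>. indicator A \<omega> * D (s + i) \<omega> \<partial>M)"
      unfolding S_def sum_distrib_left
      by (rule Bochner_Integration.integral_sum) (rule int[OF integrable_demand])
    also have "\<dots> = (\<Sum>i<\<tau>. \<integral>\<omega>. indicator A \<omega> * demand.mean \<partial>M)"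
      using set_integral_fresh_demand[OF sets_state_hist[OF A]]
      by (simp add: set_lebesgue_integral_def)
    also have "\<dots> = (\<integral>\<omega>. indicator A \<omega> * (\<tau> * demand.mean) \<partial>M)"
      by simp
    finally show "(\<integral>\<omega>\<in>A. I (s + \<tau>) \<omega> \<partial>M) = (\<integral>\<omega>\<in>A. position s \<omega> - \<tau> * demand.mean \<partial>M)"
      by (simp add: inventory_eq S_def[symmetric] set_lebesgue_integral_def right_diff_distrib
          Bochner_Integration.integral_diff[OF int[OF int_pos] int[OF int_S]]
          Bochner_Integration.integral_diff[OF int[OF int_pos] int[OF integrable_const]])
  next
    have "(\<lambda>\<omega>. I s \<omega> + (\<Sum>i<\<tau>. q (Suc (s + i)) \<omega>) - \<tau> * demand.mean) \<in> borel_measurable (state s)"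
      using measurable_state_order[of "Suc _" s]
      by (intro borel_measurable_diff borel_measurable_add borel_measurable_sum
          measurable_state_inventory) auto
    then show "(\<lambda>\<omega>. position s \<omega> - \<tau> * demand.mean) \<in> borel_measurable (state s)"
      by (simp add: position_def)
  qed (use int_pos integrable_inventory in auto)
  moreover have "AE \<omega> in M. real_cond_exp M (state s) (I (s + \<tau>)) \<omega> = U"
    using policy by (simp add: bo_PIL_def bo_algebra_def)
  ultimately show ?thesis
    by eventually_elim auto
qed

lemma integral_inventory_eq:
  assumes "C-lipschitz_on UNIV \<phi>"
  shows "(\<integral>\<omega>. \<phi> (I (t + \<tau>) \<omega>) \<partial>M) = bo_value law \<phi> \<tau> (U + \<tau> * demand.mean)"
proof -
  have "(\<integral>\<omega>. \<phi> (I (t + \<tau>) \<omega>) \<partial>M) = (\<integral>\<omega>. \<phi> (U + \<tau> * demand.mean - (\<Sum>i<\<tau>. D (t + i) \<omega>)) \<partial>M)"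
  proof (rule integral_cong_AE)
    show "(\<lambda>\<omega>. \<phi> (I (t + \<tau>) \<omega>)) \<in> borel_measurable M"
      by (intro borel_measurable_integrable integrable_compose_lipschitz[OF assms] integrable_inventory)
    show "(\<lambda>\<omega>. \<phi> (U + \<tau> * demand.mean - (\<Sum>i<\<tau>. D (t + i) \<omega>))) \<in> borel_measurable M"
      by (intro borel_measurable_integrable integrable_compose_lipschitz[OF assms]
          Bochner_Integration.integrable_diff Bochner_Integration.integrable_sum integrable_demand) auto
    show "AE \<omega> in M. \<phi> (I (t + \<tau>) \<omega>) = \<phi> (U + \<tau> * demand.mean - (\<Sum>i<\<tau>. D (t + i) \<omega>))"
      using AE_position[of t] by eventually_elim (simp add: inventory_eq)
  qed
  also have "\<dots> = (\<integral>\<omega>. bo_value law \<phi> \<tau> (U + \<tau> * demand.mean) \<partial>M)"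
    by (rule integral_bo_value[symmetric, OF assms]) auto
  finally show ?thesis by (simp add: prob_space)
qed

end

subsection \<open>Comparison of the costs\<close>

text \<open>At \<open>z = I - D\<close> of the same period this is the period cost of either system;
  the negative part of \<open>z\<close> is the demand that is lost or back-ordered.\<close>

definition newsvendor_loss :: "real \<Rightarrow> real \<Rightarrow> real \<Rightarrow> real" where
  "newsvendor_loss h p z = h * max 0 z + p * max 0 (- z)"

lemma newsvendor_loss_lipschitz:
  assumes "0 \<le> h" and "0 \<le> p" shows "(h + p)-lipschitz_on UNIV (newsvendor_loss h p)"
proof (rule lipschitz_onI)
  fix y z :: real
  have "\<bar>max 0 y - max 0 z\<bar> \<le> \<bar>y - z\<bar>" "\<bar>max 0 (- y) - max 0 (- z)\<bar> \<le> \<bar>y - z\<bar>"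
    by auto
  then have "\<bar>h * (max 0 y - max 0 z)\<bar> \<le> h * \<bar>y - z\<bar>" "\<bar>p * (max 0 (- y) - max 0 (- z))\<bar> \<le> p * \<bar>y - z\<bar>"
    using assms by (auto simp: abs_mult intro: mult_left_mono)
  then show "dist (newsvendor_loss h p y) (newsvendor_loss h p z) \<le> (h + p) * dist y z"
    unfolding newsvendor_loss_def dist_real_def distrib_right right_diff_distrib by linarith
qed (use assms in simp)

lemma newsvendor_loss_convex:
  assumes "0 \<le> h" and "0 \<le> p" shows "convex_on UNIV (newsvendor_loss h p)"
proof (rule convex_onI)
  fix t y z :: real
  assume t: "0 < t" "t < 1"
  have *: "max 0 ((1 - t) * u + t * v) \<le> (1 - t) * max 0 u + t * max 0 v" for u v :: real
    using t by (smt (verit) mult_left_mono mult_nonneg_nonneg)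
  show "newsvendor_loss h p ((1 - t) *\<^sub>R y + t *\<^sub>R z)
      \<le> (1 - t) * newsvendor_loss h p y + t * newsvendor_loss h p z"
    using mult_left_mono[OF *[of y z] assms(1)] mult_left_mono[OF *[of "- y" "- z"] assms(2)]
    by (simp add: newsvendor_loss_def algebra_simps)
qed simp

theorem lemma8:
  fixes M :: "'a measure" and D q qB :: "nat \<Rightarrow> 'a \<Rightarrow> real"
    and x :: "nat \<Rightarrow> real" and \<tau> t :: nat and h p U :: real
  assumes "prob_space M"
    and "prob_space.indep_vars M (\<lambda>_. borel) D UNIV"
    and "\<And>s. distr M borel (D s) = distr M borel (D 0)"
    and "\<And>s. AE \<omega> in M. 0 \<le> D s \<omega>"
    and "\<And>s. integrable M (D s)"
    and "h > 0" and "p > 0" and "U \<ge> 0"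
    and "\<And>i. i < max 1 \<tau> \<Longrightarrow> 0 \<le> x i"
    and "initial_pipeline M \<tau> x q" and "ls_PIL M \<tau> x D U q"
    and "initial_pipeline M \<tau> x qB" and "bo_PIL M \<tau> x D U qB"
    and "(\<integral>\<omega>. ls_prev \<tau> x D q \<tau> \<omega> \<partial>M) \<le> U"
    and "t \<ge> \<tau>"
  shows "p * (\<integral>\<omega>. ls_L \<tau> x D q t \<omega> \<partial>M) + h * (\<integral>\<omega>. ls_J \<tau> x D q t \<omega> \<partial>M)
           = (\<integral>\<omega>. ls_cost h p \<tau> x D q t \<omega> \<partial>M) \<and>
         (\<integral>\<omega>. ls_cost h p \<tau> x D q t \<omega> \<partial>M) \<le> (\<integral>\<omega>. bo_cost h p \<tau> x D qB t \<omega> \<partial>M) \<and>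
         (\<integral>\<omega>. bo_cost h p \<tau> x D qB t \<omega> \<partial>M)
           = p * (\<integral>\<omega>. bo_B \<tau> x D qB t \<omega> \<partial>M) + h * (\<integral>\<omega>. bo_J \<tau> x D qB t \<omega> \<partial>M)"
proof -
  interpret prob_space M by fact
  interpret iid_demand M D
    by unfold_locales (fact+)
  interpret lost: lost_sales_PIL M D \<tau> x U q
    by unfold_locales (fact+)
  interpret bo: back_order_PIL M D \<tau> x U qB
    by unfold_locales (fact+)
  define s where "s = t - \<tau>"
  have t: "t = s + \<tau>"
    using \<open>t \<ge> \<tau>\<close> by (simp add: s_def)
  \<comment> \<open>The expected cost of period \<open>t\<close> as a function of the inventory at
    its start. Integrating out the demand of period \<open>t\<close> leaves a convex Lipschitz
    function, so the comparison of costs becomes one of inventory levels.\<close>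
  define \<phi> where "\<phi> = bo_value law (newsvendor_loss h p) 1"
  have loss: "(h + p)-lipschitz_on UNIV (newsvendor_loss h p)" "convex_on UNIV (newsvendor_loss h p)"
    using newsvendor_loss_lipschitz newsvendor_loss_convex \<open>h > 0\<close> \<open>p > 0\<close> by auto
  have \<phi>: "(h + p)-lipschitz_on UNIV \<phi>" "convex_on UNIV \<phi>"
    unfolding \<phi>_def by (rule demand.bo_value_lipschitz[OF loss(1)] demand.bo_value_convex[OF loss])+
  have cost: "(\<integral>\<omega>. newsvendor_loss h p (X \<omega> - D t \<omega>) \<partial>M) = (\<integral>\<omega>. \<phi> (X \<omega>) \<partial>M)"
    if "integrable M X" "X \<in> borel_measurable (hist t)" for X
    using integral_bo_value[OF loss(1) that, of 1] by (simp add: \<phi>_def)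
  have int: "integrable M (lost.I t)" "integrable M (bo.I t)"
    using lost.integrable_inventory bo.integrable_inventory[of s] t by auto
  have "(\<integral>\<omega>. ls_cost h p \<tau> x D q t \<omega> \<partial>M) = (\<integral>\<omega>. \<phi> (lost.I t \<omega>) \<partial>M)"
    using cost[OF int(1) lost.system_adapted(2)]
    by (simp add: ls_cost_def ls_J_def ls_L_def newsvendor_loss_def)
  moreover have "(\<integral>\<omega>. bo_cost h p \<tau> x D qB t \<omega> \<partial>M) = (\<integral>\<omega>. \<phi> (bo.I t \<omega>) \<partial>M)"
    using cost[OF int(2) bo.system_adapted(2)]
    by (simp add: bo_cost_def bo_J_def bo_B_def newsvendor_loss_def)
  ultimately have "(\<integral>\<omega>. ls_cost h p \<tau> x D q t \<omega> \<partial>M) \<le> (\<integral>\<omega>. bo_cost h p \<tau> x D qB t \<omega> \<partial>M)"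
    using lost.integral_inventory_le[OF \<phi>, of s] bo.integral_inventory_eq[OF \<phi>(1), of s]
    unfolding t by simp
  then show ?thesis
    using int integrable_demand[of t]
    by (simp add: ls_cost_def ls_J_def ls_L_def bo_cost_def bo_J_def bo_B_def)
qed

end
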